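(* There exist a constant $c_0\in(0,1)$ and a 1-sided error, nonadaptive, $t$-online-erasure-resilient $\varepsilon$-tester for linearity of functions $f:\{0,1\}^d\to\{0,1\}$ that is correct whenever $t\le c_0\cdot \varepsilon^{5/4}\cdot 2^{d/4}$ and makes $O\big(\min\big(\frac{1}{\varepsilon}\log\frac{t}{\varepsilon},\ \frac{t}{\varepsilon}\big)\big)$ queries.
   Context: Online-erasure model. An input is a function $f:D\to R$ on a finite domain $D$. An algorithm accesses $f$ only through an oracle $\mathcal{O}$ by querying points $x\in D$ one at a time and receiving $\mathcal{O}(x)$. Initially $\mathcal{O}(x)=f(x)$ for all $x\in D$. For $t\in\mathbb{N}$, a $t$-online-erasure oracle, after answering each query, may choose up to $t$ points $x\in D$ and set $\mathcal{O}(x)=\perp$ (a special "erased" symbol); these values are used to answer all future queries. The choice of erasures (the adversarial strategy) may depend on $f$, on the queries and answers so far, and on the algorithm's code, but not on the algorithm's future random coins; the algorithm does not know where erasures are. A property $\mathcal{P}$ is a set of functions; $f$ is $\varepsilon$-far from $\mathcal{P}$ if for every $g\in\mathcal{P}$, $f$ and $g$ differ on at least an $\varepsilon$ fraction of $D$. A $t$-online-erasure-resilient $\varepsilon$-tester for $\mathcal{P}$ is a randomized algorithm that, given $t,\varepsilon$ and access to $f$ via a $t$-online-erasure oracle, for every adversarial strategy accepts with probability at least $2/3$ if $f\in\mathcal{P}$ and rejects with probability at least $2/3$ if $f$ is $\varepsilon$-far from $\mathcal{P}$. It has 1-sided error if it accepts every $f\in\mathcal{P}$ with probability 1; it is nonadaptive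 if its queries do not depend on answers to previous queries. A function $f:\{0,1\}^d\to\{0,1\}$ is linear if there is $S\subseteq[d]$ with $f(x)=\sum_{i\in S}x[i]\bmod 2$ for all $x=(x[1],\dots,x[d])$. *)

theory Defs
  imports "HOL-Probability.Probability_Mass_Function"
begin

text \<open>Points of the hypercube {0,1}^d are bool lists of length d (True = 1).\<close>
type_synonym point = "bool list"

definition cube :: "nat \<Rightarrow> point set" where
  "cube d = {x. length x = d}"

definition linear_fun :: "nat \<Rightarrow> (point \<Rightarrow> bool) \<Rightarrow> bool" where
  "linear_fun d f \<longleftrightarrow> (\<exists>S \<subseteq> {..<d}. \<forall>x \<in> cube d.
      f x = ((\<Sum>i\<in>S. if x ! i then 1 else 0 :: nat) mod 2 = 1))"

definition eps_far_linear :: "nat \<Rightarrow> real \<Rightarrow> (point \<Rightarrow> bool) \<Rightarrow> bool" where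
  "eps_far_linear d \<epsilon> f \<longleftrightarrow> (\<forall>g. linear_fun d g \<longrightarrow>
      real (card {x \<in> cube d. f x \<noteq> g x}) \<ge> \<epsilon> * 2 ^ d)"

text \<open>An adversarial strategy: given the history of (query, answer) pairs so far
  (answer None = erased symbol), it chooses the set of points to erase after the
  latest query is answered. Dependence on f and on the algorithm's code is allowed
  since the strategy is quantified after f and the algorithm.\<close>
type_synonym adversary = "(point \<times> bool option) list \<Rightarrow> point set"

definition valid_adversary :: "nat \<Rightarrow> adversary \<Rightarrow> bool" where
  "valid_adversary t adv \<longleftrightarrow> (\<forall>h. finite (adv h) \<and> card (adv h) \<le> t)"

fun run_answers :: "(point \<Rightarrow> bool) \<Rightarrow> adversary \<Rightarrow> (point \<times> bool option) list
      \<Rightarrow> point set \<Rightarrow> point list \<Rightarrow> bool option list" where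
  "run_answers f adv h E [] = []"
| "run_answers f adv h E (q # qs) =
     (let a = (if q \<in> E then None else Some (f q)); h' = h @ [(q, a)]
      in a # run_answers f adv h' (E \<union> adv h') qs)"

definition answers :: "(point \<Rightarrow> bool) \<Rightarrow> adversary \<Rightarrow> point list \<Rightarrow> bool option list" where
  "answers f adv qs = run_answers f adv [] {} qs"

text \<open>A nonadaptive randomized algorithm: a distribution over pairs
  (query sequence, decision rule on the answers); True = accept.\<close>
type_synonym nonadaptive_alg = "(point list \<times> (bool option list \<Rightarrow> bool)) pmf"

definition accept_prob :: "nonadaptive_alg \<Rightarrow> (point \<Rightarrow> bool) \<Rightarrow> adversary \<Rightarrow> real" where
  "accept_prob T f adv = measure_pmf.prob T {(qs, dec). dec (answers f adv qs)}"

definition one_sided_oe_linearity_tester :: "nat \<Rightarrow> nat \<Rightarrow> real \<Rightarrow> nonadaptive_alg \<Rightarrow> bool" where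
  "one_sided_oe_linearity_tester d t \<epsilon> T \<longleftrightarrow>
     (\<forall>(qs, dec) \<in> set_pmf T. set qs \<subseteq> cube d) \<and>
     (\<forall>f adv. valid_adversary t adv \<longrightarrow> linear_fun d f \<longrightarrow> accept_prob T f adv = 1) \<and>
     (\<forall>f adv. valid_adversary t adv \<longrightarrow> eps_far_linear d \<epsilon> f \<longrightarrow> 1 - accept_prob T f adv \<ge> 2/3)"

end

theory Submission
  imports Defs
begin

text \<open>
  One round draws \<open>u, v \<in> ({0,1}\<^sup>d)\<^sup>m\<close> with \<open>m\<close> even, queries all these points, then picks
  one of \<open>u\<^sub>i, v\<^sub>i\<close> for each \<open>i\<close> at random and queries the sum of the \<open>m\<close> points picked.
  If \<open>f\<close> is \<open>\<epsilon>\<close>-far from linear, all Fourier coefficients of \<open>(-1)\<^sup>f\<close> are at most \<open>1 - 2\<epsilon>\<close>, so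
  the bias of the linearity check on a round is \<open>\<Sum>\<^sub>a f\<^sub>a\<^bsup>m+1\<^esup> \<le> (1 - 2\<epsilon>)\<^bsup>m-1\<^esup>\<close>, which is at
  most \<open>1/3\<close> once \<open>m > 1/\<epsilon>\<close>; four independent rounds then suffice.
  The adversary has erased few points of the cube when the uniform points are queried, and the
  sum is nearly uniform over \<open>2\<^sup>m\<close> mostly distinct values, so \<open>m\<close> of order \<open>1/\<epsilon> + log t\<close>
  makes it unlikely that any query is erased. This is \<open>O(1/\<epsilon> + log t)\<close> queries, which is
  below both terms of the minimum. For \<open>\<epsilon> > 3/4\<close> and \<open>t \<ge> 1\<close>, where the required bound may be
  less than one query, no function is \<open>\<epsilon>\<close>-far by Parseval and nothing is queried.
\<close>

section \<open>Averages over finite sets\<close>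

text \<open>Expectation under the uniform distribution on \<open>A\<close>; probabilities appear as
  averages of \<open>of_bool\<close>, so the analysis runs on finite sums. An average over
  \<open>tuples n A\<close> models \<open>n\<close> independent draws from \<open>A\<close>. The
  empty set has average 0, hence the nonemptiness conditions on constants.\<close>

definition avg :: "'a set \<Rightarrow> ('a \<Rightarrow> real) \<Rightarrow> real" where
  "avg A F = (\<Sum>x\<in>A. F x) / real (card A)"

definition tuples :: "nat \<Rightarrow> 'a set \<Rightarrow> 'a list set" where
  "tuples n A = {xs. set xs \<subseteq> A \<and> length xs = n}"

lemma avg_mono: "(\<And>x. x \<in> A \<Longrightarrow> F x \<le> G x) \<Longrightarrow> avg A F \<le> avg A G"
  unfolding avg_def by (intro divide_right_mono sum_mono) auto

lemma avg_cong: "A = B \<Longrightarrow> (\<And>x. x \<in> B \<Longrightarrow> F x = G x) \<Longrightarrow> avg A F = avg B G"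
  unfolding avg_def by (metis (no_types, lifting) sum.cong)

lemma avg_add: "avg A (\<lambda>x. F x + G x) = avg A F + avg A G"
  unfolding avg_def by (simp add: sum.distrib add_divide_distrib)

lemma avg_cmult: "avg A (\<lambda>x. c * F x) = c * avg A F"
  unfolding avg_def by (simp add: sum_distrib_left[symmetric])

lemma avg_multc: "avg A (\<lambda>x. F x * c) = avg A F * c"
  using avg_cmult[of A c F] by (simp add: mult.commute)

lemma avg_const: "finite A \<Longrightarrow> A \<noteq> {} \<Longrightarrow> avg A (\<lambda>x. c) = c"
  unfolding avg_def by (simp add: card_eq_0_iff)

lemma avg_sum: "avg A (\<lambda>x. \<Sum>i\<in>I. F i x) = (\<Sum>i\<in>I. avg A (F i))"
  unfolding avg_def by (subst sum.swap) (simp add: sum_divide_distrib)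

lemma avg_swap: "avg A (\<lambda>x. avg B (\<lambda>y. F x y)) = avg B (\<lambda>y. avg A (\<lambda>x. F x y))"
  unfolding avg_def
  by (simp add: sum_divide_distrib[symmetric] sum.swap[of _ B A] mult.commute)

lemma avg_Times: "avg (A \<times> B) F = avg A (\<lambda>x. avg B (\<lambda>y. F (x, y)))"
  unfolding avg_def
  by (simp add: card_cartesian_product sum.cartesian_product sum_divide_distrib[symmetric] mult.commute)

lemma avg_of_bool_eq:
  assumes "finite A" "z \<in> A"
  shows "avg A (\<lambda>x. of_bool (x = z)) = 1 / real (card A)"
  using assms unfolding avg_def of_bool_def by simp

lemma avg_le_const: "finite A \<Longrightarrow> A \<noteq> {} \<Longrightarrow> (\<And>x. x \<in> A \<Longrightarrow> F x \<le> c) \<Longrightarrow> avg A F \<le> c"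
  using avg_mono[of A F "\<lambda>_. c"] by (simp add: avg_const)

lemma tuples_0: "tuples 0 A = {[]}"
  by (auto simp: tuples_def)

lemma tuples_Suc: "tuples (Suc n) A = (\<lambda>(x, xs). x # xs) ` (A \<times> tuples n A)"
  by (auto simp: tuples_def length_Suc_conv image_iff)

lemma finite_tuples [simp]: "finite A \<Longrightarrow> finite (tuples n A)"
  unfolding tuples_def by (rule finite_lists_length_eq)

lemma tuples_nonempty: "A \<noteq> {} \<Longrightarrow> tuples n A \<noteq> {}"
proof -
  assume "A \<noteq> {}"
  then obtain a where "a \<in> A" by auto
  then have "replicate n a \<in> tuples n A" by (auto simp: tuples_def)
  then show ?thesis by blast
qed

lemma avg_tuples_0: "avg (tuples 0 A) F = F []"
  by (simp add: tuples_0 avg_def)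

lemma avg_tuples_Suc:
  "avg (tuples (Suc n) A) F = avg A (\<lambda>x. avg (tuples n A) (\<lambda>xs. F (x # xs)))"
proof -
  have inj: "inj_on (\<lambda>(x, xs). x # xs) (A \<times> tuples n A)"
    by (auto simp: inj_on_def)
  have "avg (tuples (Suc n) A) F = avg (A \<times> tuples n A) (\<lambda>p. F (fst p # snd p))"
    unfolding avg_def tuples_Suc card_image[OF inj] sum.reindex[OF inj]
    by (simp add: case_prod_unfold o_def)
  then show ?thesis by (simp add: avg_Times)
qed

text \<open>Independence of the coordinates: the expectation of a product of independent factors is
  the product of their expectations.\<close>

lemma avg_tuples_prod_list:
  "avg (tuples n A) (\<lambda>xs. prod_list (map g xs)) = avg A g ^ n"
  by (induction n) (simp_all add: avg_tuples_0 avg_tuples_Suc avg_cmult avg_multc)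

section \<open>Fourier analysis on the cube\<close>

lemma cube_eq_tuples: "cube d = tuples d UNIV"
  by (auto simp: cube_def tuples_def)

lemma finite_cube [simp]: "finite (cube d)"
  by (simp add: cube_eq_tuples)

lemma card_cube: "card (cube d) = 2 ^ d"
  using card_lists_length_eq[of "UNIV :: bool set" d] by (simp add: cube_eq_tuples tuples_def)

lemma cube_nonempty [simp]: "cube d \<noteq> {}"
  using card_cube[of d] by (metis card.empty power_not_zero zero_neq_numeral)

section \<open>Characters of the cube and sums of points\<close>

definition sgb :: "bool \<Rightarrow> real" where
  "sgb b = (if b then -1 else 1)"

lemma sgb_sq [simp]: "sgb b * sgb b = 1"
  by (simp add: sgb_def)

text \<open>The Walsh character \<open>(-1)\<close> to the inner product of \<open>a\<close> and
  \<open>x\<close>; a point \<open>a\<close> encodes the set of coordinates on which it is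
  True.\<close>

fun chi :: "point \<Rightarrow> point \<Rightarrow> real" where
  "chi (a # as) (x # xs) = sgb (a \<and> x) * chi as xs"
| "chi _ _ = 1"

fun xor :: "point \<Rightarrow> point \<Rightarrow> point" where
  "xor (x # xs) (y # ys) = (x \<noteq> y) # xor xs ys"
| "xor _ _ = []"

fun xsum :: "nat \<Rightarrow> point list \<Rightarrow> point" where
  "xsum d [] = replicate d False"
| "xsum d (x # xs) = xor x (xsum d xs)"

lemma length_xor: "length (xor x y) = min (length x) (length y)"
  by (induction x y rule: xor.induct) auto

lemma xor_cube: "x \<in> cube d \<Longrightarrow> y \<in> cube d \<Longrightarrow> xor x y \<in> cube d"
  by (simp add: cube_def length_xor)

lemma xsum_cube: "set xs \<subseteq> cube d \<Longrightarrow> xsum d xs \<in> cube d"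
  by (induction xs) (auto simp: xor_cube, simp add: cube_def)

lemma xor_assoc: "xor (xor x y) z = xor x (xor y z)"
proof (induction x y arbitrary: z rule: xor.induct)
  case (1 x xs y ys)
  then show ?case by (cases z) auto
qed auto

lemma xor_commute: "xor x y = xor y x"
  by (induction x y rule: xor.induct) auto

lemma xor_left_commute: "xor x (xor y z) = xor y (xor x z)"
  by (metis xor_assoc xor_commute)

lemma xor_cancel: "length x = length y \<Longrightarrow> xor x (xor x y) = y"
  by (induction x y rule: list_induct2) auto

lemma xor_replicate_False: "xor (replicate (length x) False) x = x"
  by (induction x) auto

lemma xor_eq_iff:
  assumes "x \<in> cube d" "y \<in> cube d" "z \<in> cube d"
  shows "xor x y = z \<longleftrightarrow> y = xor x z"
  using assms xor_cancel[of x] by (auto simp: cube_def)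

lemma chi_replicate_False: "chi a (replicate d False) = 1"
proof (induction d arbitrary: a)
  case (Suc d)
  then show ?case by (cases a) (auto simp: sgb_def)
qed simp

lemma chi_xor: "length x = length y \<Longrightarrow> chi a (xor x y) = chi a x * chi a y"
proof (induction x y arbitrary: a rule: list_induct2)
  case (Cons x xs y ys)
  then show ?case by (cases a) (auto simp: sgb_def)
qed simp

lemma chi_xsum: "set xs \<subseteq> cube d \<Longrightarrow> chi a (xsum d xs) = prod_list (map (chi a) xs)"
proof (induction xs)
  case (Cons x xs)
  then have "length x = length (xsum d xs)"
    using xsum_cube[of xs d] by (simp add: cube_def)
  with Cons show ?case by (simp add: chi_xor)
qed (simp add: chi_replicate_False)

lemma chi_cases: "chi a x = 1 \<or> chi a x = -1"
  by (induction a x rule: chi.induct) (auto simp: sgb_def)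

text \<open>Links the recursive character to the sum over indices that \<open>linear_fun\<close>
  uses.\<close>

lemma chi_eq_minus_one_power:
  "length a = length x \<Longrightarrow> chi a x = (-1) ^ (\<Sum>i<length x. of_bool (a ! i \<and> x ! i))"
proof (induction a x rule: list_induct2)
  case (Cons a as x xs)
  then show ?case
    by (simp add: sum.lessThan_Suc_shift power_add sgb_def del: sum.lessThan_Suc)
qed simp

lemma sgb_parity: "sgb (n mod 2 = 1) = (-1) ^ n"
  by (cases "even n") (auto simp: sgb_def even_iff_mod_2_eq_zero odd_iff_mod_2_eq_one)

lemma parity_eq_chi:
  assumes "x \<in> cube d" "a \<in> cube d" "S = {i. i < d \<and> a ! i}"
  shows "sgb ((\<Sum>i\<in>S. if x ! i then 1 else 0 :: nat) mod 2 = 1) = chi a x"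
proof -
  have "(\<Sum>i\<in>S. if x ! i then 1 else 0 :: nat) = (\<Sum>i<d. of_bool (a ! i \<and> x ! i))"
    unfolding assms(3) by (rule sum.mono_neutral_cong_left) auto
  then show ?thesis
    using assms chi_eq_minus_one_power[of a x] unfolding sgb_parity by (simp add: cube_def)
qed

section \<open>Linear functions correspond to characters\<close>

lemma linear_fun_chiE:
  assumes "linear_fun d g"
  obtains a where "a \<in> cube d" "\<And>x. x \<in> cube d \<Longrightarrow> sgb (g x) = chi a x"
proof -
  obtain S where S: "S \<subseteq> {..<d}" and g: "\<And>x. x \<in> cube d \<Longrightarrow>
      g x = ((\<Sum>i\<in>S. if x ! i then 1 else 0 :: nat) mod 2 = 1)"
    using assms unfolding linear_fun_def by blast
  define a where "a = map (\<lambda>i. i \<in> S) [0..<d]"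
  have a: "a \<in> cube d" by (simp add: a_def cube_def)
  have "S = {i. i < d \<and> a ! i}" using S by (auto simp: a_def)
  then show ?thesis using that[OF a] parity_eq_chi[OF _ a] g by simp
qed

lemma linear_fun_chi:
  assumes "a \<in> cube d"
  shows "linear_fun d (\<lambda>x. chi a x = -1)"
proof -
  have "(chi a x = -1) = ((\<Sum>i\<in>{i. i < d \<and> a ! i}. if x ! i then 1 else 0 :: nat) mod 2 = 1)"
    if "x \<in> cube d" for x
    using parity_eq_chi[OF that assms refl] by (auto simp: sgb_def split: if_splits)
  then show ?thesis unfolding linear_fun_def by (intro exI[of _ "{i. i < d \<and> a ! i}"]) auto
qed

section \<open>Orthogonality and the Fourier expansion\<close>

lemma sum_cube_Suc: "(\<Sum>a\<in>cube (Suc d). F a) = (\<Sum>a\<in>cube d. F (True # a) + F (False # a))"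
proof -
  have inj: "inj_on (\<lambda>(x, xs). x # xs) (UNIV \<times> tuples d UNIV)"
    by (auto simp: inj_on_def)
  have "(\<Sum>a\<in>cube (Suc d). F a) = (\<Sum>p\<in>UNIV \<times> tuples d UNIV. F (fst p # snd p))"
    unfolding cube_eq_tuples tuples_Suc sum.reindex[OF inj] by (simp add: case_prod_unfold o_def)
  also have "\<dots> = (\<Sum>b\<in>UNIV. \<Sum>a\<in>cube d. F (b # a))"
    by (simp add: sum.cartesian_product cube_eq_tuples case_prod_unfold)
  also have "\<dots> = (\<Sum>a\<in>cube d. F (True # a) + F (False # a))"
    by (simp add: UNIV_bool sum.distrib add.commute)
  finally show ?thesis .
qed

text \<open>The sum runs over characters, for a fixed pair of points. Splitting off the first
  coordinate yields the factor \<open>sgb x0 * sgb y0 + 1\<close>, which is 2 if the first bits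
  agree and 0 otherwise.\<close>

lemma chi_orthogonal:
  assumes "x \<in> cube d" "y \<in> cube d"
  shows "(\<Sum>a\<in>cube d. chi a x * chi a y) = (if x = y then 2 ^ d else 0)"
  using assms
proof (induction d arbitrary: x y)
  case 0
  then show ?case by (simp add: cube_def)
next
  case (Suc d)
  then obtain x0 x' y0 y' where [simp]: "x = x0 # x'" "y = y0 # y'" "x' \<in> cube d" "y' \<in> cube d"
    unfolding cube_def mem_Collect_eq length_Suc_conv by blast
  have "(\<Sum>a\<in>cube (Suc d). chi a x * chi a y)
      = (sgb x0 * sgb y0 + 1) * (\<Sum>a\<in>cube d. chi a x' * chi a y')"
    by (cases x0; cases y0) (simp_all add: sum_cube_Suc sum.distrib sgb_def flip: sum_distrib_left)
  then show ?case by (simp add: Suc.IH sgb_def)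
qed

definition fourier :: "nat \<Rightarrow> (point \<Rightarrow> bool) \<Rightarrow> point \<Rightarrow> real" where
  "fourier d f a = avg (cube d) (\<lambda>x. sgb (f x) * chi a x)"

lemma fourier_inversion:
  assumes "y \<in> cube d"
  shows "(\<Sum>a\<in>cube d. fourier d f a * chi a y) = sgb (f y)"
proof -
  have "(\<Sum>a\<in>cube d. fourier d f a * chi a y)
      = avg (cube d) (\<lambda>x. \<Sum>a\<in>cube d. sgb (f x) * chi a x * chi a y)"
    unfolding fourier_def avg_sum by (simp add: avg_multc)
  also have "\<dots> = avg (cube d) (\<lambda>x. if x = y then sgb (f y) * 2 ^ d else 0)"
    using assms
    by (intro avg_cong refl) (auto simp: mult.assoc sum_distrib_left[symmetric] chi_orthogonal)
  also have "\<dots> = sgb (f y)"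
    using assms by (simp add: avg_def card_cube)
  finally show ?thesis .
qed

text \<open>One factor of each square is replaced by its defining average; after exchanging the
  sums, inversion turns the integrand into \<open>sgb (f x) * sgb (f x) = 1\<close>.\<close>

lemma fourier_parseval: "(\<Sum>a\<in>cube d. fourier d f a ^ 2) = 1"
proof -
  have "(\<Sum>a\<in>cube d. fourier d f a ^ 2)
      = (\<Sum>a\<in>cube d. avg (cube d) (\<lambda>x. fourier d f a * (sgb (f x) * chi a x)))"
    unfolding avg_cmult by (simp add: fourier_def power2_eq_square)
  also have "\<dots> = avg (cube d) (\<lambda>x. sgb (f x) * (\<Sum>a\<in>cube d. fourier d f a * chi a x))"
    unfolding avg_sum[symmetric] by (simp add: sum_distrib_left mult_ac)
  also have "\<dots> = avg (cube d) (\<lambda>x. 1)"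
    by (intro avg_cong refl) (simp add: fourier_inversion)
  finally show ?thesis by (simp add: avg_const)
qed

text \<open>Points of agreement with the character contribute 1 and points of disagreement -1, so
  the coefficient is 1 minus twice the distance. The bound is one-sided: a coefficient may still be
  close to -1, as for the complement of a linear function.\<close>

lemma fourier_le_of_far:
  assumes "eps_far_linear d \<epsilon> f" "a \<in> cube d"
  shows "fourier d f a \<le> 1 - 2 * \<epsilon>"
proof -
  let ?D = "{x \<in> cube d. f x \<noteq> (chi a x = -1)}"
  have far: "\<epsilon> * 2 ^ d \<le> real (card ?D)"
    using assms linear_fun_chi unfolding eps_far_linear_def by blast
  have eq: "sgb (f x) * chi a x = 1 - 2 * of_bool (f x \<noteq> (chi a x = -1))" for x
    using chi_cases[of a x] by (auto simp: sgb_def)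
  have "(\<Sum>x\<in>cube d. of_bool (f x \<noteq> (chi a x = -1))) = real (card ?D)"
    by (simp add: of_bool_def sum.If_cases Int_def)
  then have "fourier d f a = (2 ^ d - 2 * real (card ?D)) / 2 ^ d"
    unfolding fourier_def avg_def eq sum_subtractf sum_distrib_left[symmetric]
    by (simp add: card_cube)
  also have "\<dots> \<le> (2 ^ d - 2 * (\<epsilon> * 2 ^ d)) / 2 ^ d"
    using far by (intro divide_right_mono) auto
  also have "\<dots> = 1 - 2 * \<epsilon>" by (simp add: field_simps)
  finally show ?thesis .
qed

text \<open>The last factor is expanded into characters. Each character of the sum splits into a
  product over the entries, and every independent entry then averages to the same Fourier
  coefficient.\<close>

lemma avg_sum_test:
  "avg (tuples m (cube d)) (\<lambda>xs. prod_list (map (\<lambda>x. sgb (f x)) xs) * sgb (f (xsum d xs)))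
    = (\<Sum>a\<in>cube d. fourier d f a ^ Suc m)"
proof -
  have prod: "prod_list (map g xs) * prod_list (map h xs) = prod_list (map (\<lambda>x. g x * h x) xs)"
    for g h :: "point \<Rightarrow> real" and xs
    by (induction xs) (auto simp: mult_ac)
  have "avg (tuples m (cube d)) (\<lambda>xs. prod_list (map (\<lambda>x. sgb (f x)) xs) * sgb (f (xsum d xs)))
      = avg (tuples m (cube d)) (\<lambda>xs. \<Sum>a\<in>cube d.
          fourier d f a * prod_list (map (\<lambda>x. sgb (f x) * chi a x) xs))"
  proof (intro avg_cong refl)
    fix xs assume "xs \<in> tuples m (cube d)"
    then have xs: "set xs \<subseteq> cube d" by (auto simp: tuples_def)
    have "sgb (f (xsum d xs)) = (\<Sum>a\<in>cube d. fourier d f a * prod_list (map (chi a) xs))"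
      using fourier_inversion[OF xsum_cube[OF xs]] chi_xsum[OF xs] by simp
    then show "prod_list (map (\<lambda>x. sgb (f x)) xs) * sgb (f (xsum d xs)) = (\<Sum>a\<in>cube d.
          fourier d f a * prod_list (map (\<lambda>x. sgb (f x) * chi a x) xs))"
      by (simp add: prod[symmetric] sum_distrib_left mult_ac)
  qed
  then show ?thesis
    by (simp add: avg_sum avg_cmult avg_tuples_prod_list fourier_def[symmetric])
qed

text \<open>As \<open>m\<close> is even, \<open>m - 1\<close> is odd and this power is monotone also
  on negative coefficients, so the one-sided bound suffices. The two remaining factors form a
  square, and the squares add up to 1 by Parseval.\<close>

lemma avg_sum_test_le:
  assumes far: "eps_far_linear d \<epsilon> f" and "even m" "m > 0"
  shows "avg (tuples m (cube d)) (\<lambda>xs. prod_list (map (\<lambda>x. sgb (f x)) xs) * sgb (f (xsum d xs)))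
    \<le> (1 - 2 * \<epsilon>) ^ (m - 1)"
proof -
  have "fourier d f a ^ Suc m \<le> (1 - 2 * \<epsilon>) ^ (m - 1) * fourier d f a ^ 2" if "a \<in> cube d" for a
  proof -
    have "fourier d f a ^ (m - 1) \<le> (1 - 2 * \<epsilon>) ^ (m - 1)"
      using assms fourier_le_of_far[OF far that] by (intro power_mono_odd) auto
    then have "fourier d f a ^ (m - 1) * fourier d f a ^ 2 \<le> (1 - 2 * \<epsilon>) ^ (m - 1) * fourier d f a ^ 2"
      by (rule mult_right_mono) simp
    moreover have "Suc m = (m - 1) + 2" using \<open>m > 0\<close> by simp
    ultimately show ?thesis by (metis power_add)
  qed
  then have "(\<Sum>a\<in>cube d. fourier d f a ^ Suc m)
      \<le> (\<Sum>a\<in>cube d. (1 - 2 * \<epsilon>) ^ (m - 1) * fourier d f a ^ 2)"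
    by (rule sum_mono)
  then show ?thesis
    unfolding avg_sum_test sum_distrib_left[symmetric] fourier_parseval by simp
qed

text \<open>Every coefficient would lie below -1/2, so at least four squares above 1/4 would exceed
  the Parseval sum 1.\<close>

lemma not_far_of_large_eps:
  assumes "\<epsilon> > 3/4" "d \<ge> 2"
  shows "\<not> eps_far_linear d \<epsilon> f"
proof
  assume far: "eps_far_linear d \<epsilon> f"
  have "1/4 < fourier d f a ^ 2" if "a \<in> cube d" for a
  proof -
    have "1/2 < - fourier d f a" using fourier_le_of_far[OF far that] assms by simp
    then have "(1/2) ^ 2 < (- fourier d f a) ^ 2" by (intro power_strict_mono) auto
    then show ?thesis by (simp add: power2_eq_square)
  qed
  then have "(\<Sum>a\<in>cube d. 1/4) < (\<Sum>a\<in>cube d. fourier d f a ^ 2)"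
    by (intro sum_strict_mono) auto
  moreover have "(4::real) \<le> 2 ^ d"
    using power_increasing[OF assms(2), of "2::real"] by simp
  ultimately show False by (simp add: fourier_parseval card_cube)
qed

section \<open>Erased queries\<close>

text \<open>\<open>E h\<close> is the set of points erased after the queries \<open>h\<close>, provided that none of them
  met an erasure; so \<open>hit E h qs\<close> says that some query of \<open>qs\<close>, issued after \<open>h\<close>, is erased.\<close>

fun hit :: "(point list \<Rightarrow> point set) \<Rightarrow> point list \<Rightarrow> point list \<Rightarrow> bool" where
  "hit E h [] \<longleftrightarrow> False"
| "hit E h (q # qs) \<longleftrightarrow> q \<in> E h \<or> hit E (h @ [q]) qs"

text \<open>The history is that of a run in which no query was erased. The set thus depends on the
  past queries alone, which turns the adaptive adversary into a fixed function of them. Indices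
  start at 1 since nothing is erased before the first answer.\<close>

definition erased :: "(point \<Rightarrow> bool) \<Rightarrow> adversary \<Rightarrow> point list \<Rightarrow> point set" where
  "erased f adv h = (\<Union>k\<in>{1..length h}. adv (map (\<lambda>q. (q, Some (f q))) (take k h)))"

lemma hit_append: "hit E h (qs @ qs') \<longleftrightarrow> hit E h qs \<or> hit E (h @ qs) qs'"
  by (induction qs arbitrary: h) auto

text \<open>Emptying the sets beyond \<open>N\<close> queries does not affect runs of that length,
  and makes one size bound valid for all histories.\<close>

lemma hit_truncate:
  assumes "length h + length qs \<le> N"
  shows "hit (\<lambda>h. if length h < N then E h else {}) h qs = hit E h qs"
  using assms by (induction qs arbitrary: h) auto

lemma erased_snoc:
  "erased f adv (h @ [q]) = erased f adv h \<union> adv (map (\<lambda>q. (q, Some (f q))) (h @ [q]))"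
proof -
  have "{1..length (h @ [q])} = insert (length (h @ [q])) {1..length h}" by auto
  then show ?thesis unfolding erased_def by (auto simp: Un_commute)
qed

text \<open>As long as no query meets an erasure, the actual history and the accumulated erasures
  coincide with the erasure-free ones assumed in \<open>erased\<close>.\<close>

lemma run_answers_no_hit:
  "\<not> hit (erased f adv) h qs \<Longrightarrow>
    run_answers f adv (map (\<lambda>q. (q, Some (f q))) h) (erased f adv h) qs = map (\<lambda>q. Some (f q)) qs"
proof (induction qs arbitrary: h)
  case (Cons q qs)
  then have IH: "run_answers f adv (map (\<lambda>q. (q, Some (f q))) (h @ [q])) (erased f adv (h @ [q])) qs
      = map (\<lambda>q. Some (f q)) qs" and "q \<notin> erased f adv h"
    using Cons.IH[of "h @ [q]"] Cons.prems by auto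
  then show ?case using IH unfolding erased_snoc by (simp add: Let_def)
qed simp

lemma answers_no_hit:
  "\<not> hit (erased f adv) [] qs \<Longrightarrow> answers f adv qs = map (\<lambda>q. Some (f q)) qs"
  using run_answers_no_hit[of f adv "[]" qs] by (simp add: answers_def erased_def)

lemma answers_sound:
  "list_all2 (\<lambda>q a. a = None \<or> a = Some (f q)) qs (answers f adv qs)"
proof -
  have "list_all2 (\<lambda>q a. a = None \<or> a = Some (f q)) qs (run_answers f adv h E qs)" for h E
    by (induction qs arbitrary: h E) (auto simp: Let_def)
  then show ?thesis by (simp add: answers_def)
qed

lemma erased_bound:
  assumes "valid_adversary t adv"
  shows "finite (erased f adv h)" "card (erased f adv h) \<le> t * length h"
proof -
  show "finite (erased f adv h)"
    using assms by (auto simp: erased_def valid_adversary_def)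
  have "card (erased f adv h) \<le> (\<Sum>k\<in>{1..length h}. card (adv (map (\<lambda>q. (q, Some (f q))) (take k h))))"
    unfolding erased_def by (rule card_UN_le) simp
  also have "\<dots> \<le> (\<Sum>k\<in>{1..length h}. t)"
    using assms by (intro sum_mono) (auto simp: valid_adversary_def)
  finally show "card (erased f adv h) \<le> t * length h" by (simp add: mult.commute)
qed

lemma of_bool_disj_le: "of_bool (P \<or> Q) \<le> (of_bool P + of_bool Q :: real)"
  by auto

text \<open>Union bound over the blocks. The hypothesis covers every history because the set that a
  block faces depends on the earlier blocks, while its own randomness is fresh.\<close>

lemma avg_hit_concat:
  assumes R: "finite R" "R \<noteq> {}"
    and q: "\<And>h. avg R (\<lambda>\<rho>. of_bool (hit E h (q \<rho>))) \<le> \<eta>"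
  shows "avg (tuples n R) (\<lambda>\<omega>. of_bool (hit E h (concat (map q \<omega>)))) \<le> real n * \<eta>"
proof (induction n arbitrary: h)
  case 0
  then show ?case by (simp add: avg_tuples_0)
next
  case (Suc n)
  have "avg (tuples (Suc n) R) (\<lambda>\<omega>. of_bool (hit E h (concat (map q \<omega>))))
      = avg R (\<lambda>\<rho>. avg (tuples n R) (\<lambda>\<omega>.
          of_bool (hit E h (q \<rho>) \<or> hit E (h @ q \<rho>) (concat (map q \<omega>)))))"
    by (simp add: avg_tuples_Suc hit_append)
  also have "\<dots> \<le> avg R (\<lambda>\<rho>. avg (tuples n R) (\<lambda>\<omega>.
          of_bool (hit E h (q \<rho>)) + of_bool (hit E (h @ q \<rho>) (concat (map q \<omega>)))))"
    by (intro avg_mono of_bool_disj_le)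
  also have "\<dots> = avg R (\<lambda>\<rho>. of_bool (hit E h (q \<rho>))
      + avg (tuples n R) (\<lambda>\<omega>. of_bool (hit E (h @ q \<rho>) (concat (map q \<omega>)))))"
    using R by (simp add: avg_add avg_const tuples_nonempty)
  also have "\<dots> \<le> avg R (\<lambda>\<rho>. of_bool (hit E h (q \<rho>)) + real n * \<eta>)"
    by (intro avg_mono add_left_mono Suc.IH)
  also have "\<dots> = avg R (\<lambda>\<rho>. of_bool (hit E h (q \<rho>))) + real n * \<eta>"
    using R by (simp add: avg_add avg_const)
  also have "\<dots> \<le> real (Suc n) * \<eta>"
    using q[of h] by (simp add: algebra_simps)
  finally show ?case .
qed

lemma avg_hit_uniform:
  assumes E: "\<And>h. finite (E h) \<and> real (card (E h)) \<le> K"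
  shows "avg (tuples n (cube d)) (\<lambda>xs. of_bool (hit E h xs)) \<le> real n * (K / 2 ^ d)"
proof -
  have "avg (cube d) (\<lambda>x. of_bool (hit E h [x])) \<le> K / 2 ^ d" for h
  proof -
    have "(\<Sum>x\<in>cube d. of_bool (x \<in> E h)) = real (card (cube d \<inter> E h))"
      by (simp add: of_bool_def sum.If_cases)
    also have "\<dots> \<le> real (card (E h))"
      using E[of h] by (intro of_nat_mono card_mono) auto
    also have "\<dots> \<le> K" using E by blast
    finally show ?thesis by (simp add: avg_def card_cube divide_right_mono)
  qed
  from avg_hit_concat[where q = "\<lambda>x. [x]", OF _ _ this] show ?thesis by simp
qed

section \<open>Selecting one of two points in each coordinate\<close>

fun sel :: "bool list \<Rightarrow> 'a list \<Rightarrow> 'a list \<Rightarrow> 'a list" where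
  "sel (b # bs) (u # us) (v # vs) = (if b then u else v) # sel bs us vs"
| "sel _ _ _ = []"

lemma set_sel_subset: "set (sel b u v) \<subseteq> set u \<union> set v"
  by (induction b u v rule: sel.induct) auto

lemma xsum_sel_cube:
  "u \<in> tuples m (cube d) \<Longrightarrow> v \<in> tuples m (cube d) \<Longrightarrow> xsum d (sel b u v) \<in> cube d"
  by (intro xsum_cube order.trans[OF set_sel_subset]) (auto simp: tuples_def)

text \<open>Moves the averages over the two head points innermost, so that they can be evaluated for
  fixed tails before an induction hypothesis is applied.\<close>

lemma avg_tuples_pair_Suc:
  "avg (tuples (Suc m) A) (\<lambda>u. avg (tuples (Suc m) A) (F u))
    = avg (tuples m A) (\<lambda>u. avg (tuples m A) (\<lambda>v. avg A (\<lambda>x. avg A (\<lambda>y. F (x # u) (y # v)))))"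
proof -
  have "avg (tuples (Suc m) A) (\<lambda>u. avg (tuples (Suc m) A) (F u))
      = avg A (\<lambda>x. avg (tuples m A) (\<lambda>u. avg A (\<lambda>y. avg (tuples m A) (\<lambda>v. F (x # u) (y # v)))))"
    by (simp add: avg_tuples_Suc)
  also have "\<dots> = avg A (\<lambda>x. avg (tuples m A) (\<lambda>u. avg (tuples m A) (\<lambda>v. avg A (\<lambda>y. F (x # u) (y # v)))))"
    by (subst (2) avg_swap) (rule refl)
  also have "\<dots> = avg (tuples m A) (\<lambda>u. avg A (\<lambda>x. avg (tuples m A) (\<lambda>v. avg A (\<lambda>y. F (x # u) (y # v)))))"
    by (rule avg_swap)
  also have "\<dots> = avg (tuples m A) (\<lambda>u. avg (tuples m A) (\<lambda>v. avg A (\<lambda>x. avg A (\<lambda>y. F (x # u) (y # v)))))"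
    by (intro avg_cong refl avg_swap)
  finally show ?thesis .
qed

text \<open>For a fixed \<open>b\<close> the unselected points average out, and the selected ones
  form a uniform tuple.\<close>

lemma avg_sel:
  assumes A: "finite A" "A \<noteq> {}"
  shows "avg (tuples (length b) A) (\<lambda>u. avg (tuples (length b) A) (\<lambda>v. G (sel b u v)))
    = avg (tuples (length b) A) G"
proof (induction b arbitrary: G)
  case Nil
  then show ?case by (simp add: avg_tuples_0)
next
  case (Cons c b)
  have "avg A (\<lambda>x. avg A (\<lambda>y. G (sel (c # b) (x # u) (y # v)))) = avg A (\<lambda>x. G (x # sel b u v))" for u v
    using A by (cases c) (simp_all add: avg_const)
  then show ?case
    unfolding length_Cons avg_tuples_pair_Suc
    by (simp add: Cons.IH[of "\<lambda>w. avg A (\<lambda>x. G (x # w))"] avg_tuples_Suc)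
       (rule avg_swap)
qed

text \<open>At a coordinate where \<open>b\<close> and \<open>b'\<close> differ, one sum contains
  the first point and the other sum the second. These are independent and uniform, so for any fixed
  remaining points the equation holds with probability \<open>1 / 2 ^ d\<close>. Where the bits
  agree, the common point cancels.\<close>

lemma avg_sel_collision:
  assumes "length b = length b'" "b \<noteq> b'" "z \<in> cube d"
  shows "avg (tuples (length b) (cube d)) (\<lambda>u. avg (tuples (length b) (cube d)) (\<lambda>v.
      of_bool (xsum d (sel b u v) = xor z (xsum d (sel b' u v))))) = 1 / 2 ^ d"
  using assms
proof (induction b b' rule: list_induct2)
  case (Cons c b c' b')
  let ?T = "tuples (length b) (cube d)"
  define I where "I u v = avg (cube d) (\<lambda>x. avg (cube d) (\<lambda>y.
      of_bool (xsum d (sel (c # b) (x # u) (y # v)) = xor z (xsum d (sel (c' # b') (x # u) (y # v))))))"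
    for u v
  have T: "finite ?T" "?T \<noteq> {}" by (auto simp: tuples_nonempty)
  have uniform: "avg (cube d) (\<lambda>x. of_bool (xor x s = w)) = 1 / 2 ^ d"
    if "s \<in> cube d" "w \<in> cube d" for s w
    using that avg_of_bool_eq[of "cube d" "xor s w"]
    by (simp add: xor_commute[of _ s] xor_eq_iff xor_cube card_cube cong: avg_cong)
  have I: "I u v = (if c = c' then of_bool (xsum d (sel b u v) = xor z (xsum d (sel b' u v))) else 1 / 2 ^ d)"
    if uv: "u \<in> ?T" "v \<in> ?T" for u v
  proof -
    note S = xsum_sel_cube[OF uv]
    show ?thesis
    proof (cases "c = c'")
      case True
      have "xor x (xsum d (sel b u v)) = xor z (xor x (xsum d (sel b' u v)))
          \<longleftrightarrow> xsum d (sel b u v) = xor z (xsum d (sel b' u v))" if "x \<in> cube d" for x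
        using that S \<open>z \<in> cube d\<close>
        by (simp add: xor_eq_iff xor_cube xor_left_commute[of z])
           (metis S(1) xor_cube xor_eq_iff)
      then show ?thesis
        unfolding I_def using True by (cases c') (simp_all add: avg_const cong: avg_cong)
    next
      case False
      show ?thesis
      proof (cases c)
        case True
        with False show ?thesis
          unfolding I_def using S \<open>z \<in> cube d\<close>
          \<comment> \<open>\<open>uniform\<close> averages over the point added on the left-hand
            side. Here that is the first point, whose average has to be moved inside; in the other
            case it is already innermost.\<close>
          by (subst avg_swap) (simp add: uniform xor_cube avg_const cong: avg_cong)
      next
        case c: False
        with False show ?thesis
          unfolding I_def using S \<open>z \<in> cube d\<close>
          by (simp add: uniform xor_cube avg_const cong: avg_cong)
      qed
    qed
  qed
  have "avg ?T (\<lambda>u. avg ?T (\<lambda>v. I u v)) = 1 / 2 ^ d"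
  proof (cases "c = c'")
    case True
    then show ?thesis using Cons by (simp add: I cong: avg_cong)
  next
    case False
    then show ?thesis using T by (simp add: I avg_const cong: avg_cong)
  qed
  then show ?case unfolding length_Cons avg_tuples_pair_Suc I_def by simp
qed simp

text \<open>For a fixed pair \<open>u\<close>, \<open>v\<close>, let \<open>p e\<close> be the probability over \<open>b\<close> that the sum is \<open>e\<close>. By AM-GM,
  \<open>p e \<le> \<alpha> + (p e)\<^sup>2 / (4 \<alpha>)\<close>, and the sum of the \<open>(p e)\<^sup>2\<close> is a collision probability.\<close>

lemma avg_sum_erased:
  fixes \<alpha> K :: real
  assumes E: "\<And>u v. finite (E u v) \<and> real (card (E u v)) \<le> K" and \<alpha>: "\<alpha> > 0"
  shows "avg (tuples m (cube d)) (\<lambda>u. avg (tuples m (cube d)) (\<lambda>v. avg (tuples m UNIV) (\<lambda>b.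
      of_bool (xsum d (sel b u v) \<in> E u v)))) \<le> \<alpha> * K + (1 / 2 ^ m + 1 / 2 ^ d) / (4 * \<alpha>)"
proof -
  define T where "T = tuples m (cube d)"
  define B where "B = tuples m (UNIV :: bool set)"
  define y where "y b w = xsum d (sel b (fst w) (snd w))" for b and w :: "point list \<times> point list"
  define p where "p w e = avg B (\<lambda>b. of_bool (y b w = e))" for w e
  have B: "finite B" "B \<noteq> {}" "card B = 2 ^ m"
    using card_cube[of m] by (auto simp: B_def tuples_nonempty cube_eq_tuples)
  have T: "finite T" "T \<noteq> {}" by (auto simp: T_def tuples_nonempty)
  have ycube: "y b w \<in> cube d" if "w \<in> T \<times> T" for b w
    using that xsum_sel_cube by (auto simp: y_def T_def)
  have sq: "(\<Sum>e\<in>cube d. p w e ^ 2) = avg (B \<times> B) (\<lambda>(b, b'). of_bool (y b w = y b' w))"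
    if "w \<in> T \<times> T" for w
  proof -
    have "(\<Sum>e\<in>cube d. p w e ^ 2)
        = (\<Sum>e\<in>cube d. avg B (\<lambda>b. avg B (\<lambda>b'. of_bool (y b w = e) * of_bool (y b' w = e))))"
      by (simp add: p_def power2_eq_square avg_cmult avg_multc)
    also have "\<dots> = avg B (\<lambda>b. avg B (\<lambda>b'. \<Sum>e\<in>cube d. of_bool (y b w = e) * of_bool (y b' w = e)))"
      unfolding avg_sum ..
    also have "\<dots> = avg B (\<lambda>b. avg B (\<lambda>b'. of_bool (y b w = y b' w)))"
    proof (intro avg_cong refl)
      fix b b'
      have "(\<Sum>e\<in>cube d. of_bool (y b w = e) * of_bool (y b' w = e) :: real)
          = (\<Sum>e\<in>cube d. if e = y b w then of_bool (y b w = y b' w) else 0)"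
        by (intro sum.cong) auto
      then show "(\<Sum>e\<in>cube d. of_bool (y b w = e) * of_bool (y b' w = e)) = (of_bool (y b w = y b' w) :: real)"
        using ycube[OF that] by simp
    qed
    finally show ?thesis by (simp add: avg_Times)
  qed
  have fixed: "avg B (\<lambda>b. of_bool (y b w \<in> E (fst w) (snd w)))
      \<le> \<alpha> * K + avg (B \<times> B) (\<lambda>(b, b'). of_bool (y b w = y b' w)) / (4 * \<alpha>)"
    if w: "w \<in> T \<times> T" for w
  proof -
    let ?E = "E (fst w) (snd w) \<inter> cube d"
    have fin: "finite ?E" by auto
    have amgm: "p w e \<le> \<alpha> + p w e ^ 2 / (4 * \<alpha>)" for e
    proof -
      have "0 \<le> (2 * \<alpha> - p w e) ^ 2" by simp
      then have "4 * \<alpha> * p w e \<le> 4 * \<alpha> * \<alpha> + p w e ^ 2"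
        by (simp add: power2_eq_square algebra_simps)
      then show ?thesis using \<alpha> by (simp add: field_simps)
    qed
    have "(of_bool (y b w \<in> E (fst w) (snd w)) :: real) = (\<Sum>e\<in>?E. of_bool (y b w = e))" for b
      using ycube[OF w, of b] by (simp add: of_bool_def)
    then have "avg B (\<lambda>b. of_bool (y b w \<in> E (fst w) (snd w))) = (\<Sum>e\<in>?E. p w e)"
      by (simp only: avg_sum p_def)
    also have "\<dots> \<le> (\<Sum>e\<in>?E. \<alpha> + p w e ^ 2 / (4 * \<alpha>))"
      by (intro sum_mono amgm)
    also have "\<dots> = real (card ?E) * \<alpha> + (\<Sum>e\<in>?E. p w e ^ 2) / (4 * \<alpha>)"
      by (simp add: sum.distrib sum_divide_distrib)
    also have "\<dots> \<le> K * \<alpha> + (\<Sum>e\<in>cube d. p w e ^ 2) / (4 * \<alpha>)"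
    proof (intro add_mono mult_right_mono divide_right_mono sum_mono2)
      have "card ?E \<le> card (E (fst w) (snd w))" using E by (intro card_mono) auto
      then show "real (card ?E) \<le> K" using E[of "fst w" "snd w"] by linarith
    qed (use \<alpha> in auto)
    finally show ?thesis by (simp add: sq[OF w] mult.commute)
  qed
  \<comment> \<open>Randomness of \<open>u\<close> and \<open>v\<close> enters only here: two
    distinct selections rarely have the same sum.\<close>
  have coll: "avg (T \<times> T) (\<lambda>w. of_bool (y b w = y b' w)) \<le> of_bool (b = b') + 1 / 2 ^ d"
    if b: "b \<in> B" "b' \<in> B" for b b'
  proof (cases "b = b'")
    case True
    then show ?thesis using T by (simp add: avg_const)
  next
    case False
    let ?z = "replicate d False"
    have z: "?z \<in> cube d" by (simp add: cube_def)
    have neutral: "xor ?z x = x" if "x \<in> cube d" for x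
      using that xor_replicate_False[of x] by (simp add: cube_def)
    have "avg (T \<times> T) (\<lambda>w. of_bool (y b w = y b' w))
        = avg (T \<times> T) (\<lambda>w. of_bool (y b w = xor ?z (y b' w)))"
      by (intro avg_cong refl) (simp add: neutral ycube)
    also have "\<dots> = 1 / 2 ^ d"
      using avg_sel_collision[OF _ False z] b
      by (simp add: avg_Times y_def T_def B_def tuples_def)
    finally show ?thesis using False by simp
  qed
  have "avg (T \<times> T) (\<lambda>w. avg B (\<lambda>b. of_bool (y b w \<in> E (fst w) (snd w))))
      \<le> avg (T \<times> T) (\<lambda>w. \<alpha> * K + avg (B \<times> B) (\<lambda>(b, b'). of_bool (y b w = y b' w)) * (1 / (4 * \<alpha>)))"
    using fixed by (intro avg_mono) simp
  also have "\<dots> = \<alpha> * K + avg (T \<times> T) (\<lambda>w. avg (B \<times> B) (\<lambda>(b, b'). of_bool (y b w = y b' w))) * (1 / (4 * \<alpha>))"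
    using T unfolding avg_add avg_multc by (simp add: avg_const)
  \<comment> \<open>Exchanging the averages fixes the two selections first, so that
    \<open>coll\<close> applies to each pair.\<close>
  also have "avg (T \<times> T) (\<lambda>w. avg (B \<times> B) (\<lambda>(b, b'). of_bool (y b w = y b' w)))
      = avg (B \<times> B) (\<lambda>(b, b'). avg (T \<times> T) (\<lambda>w. of_bool (y b w = y b' w)))"
    unfolding case_prod_unfold by (rule avg_swap)
  also have "\<alpha> * K + \<dots> * (1 / (4 * \<alpha>)) \<le> \<alpha> * K + (1 / 2 ^ m + 1 / 2 ^ d) * (1 / (4 * \<alpha>))"
  proof (intro add_left_mono mult_right_mono)
    have "avg (B \<times> B) (\<lambda>(b, b'). avg (T \<times> T) (\<lambda>w. of_bool (y b w = y b' w)))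
        \<le> avg (B \<times> B) (\<lambda>(b, b'). of_bool (b = b') + 1 / 2 ^ d)"
      using coll by (intro avg_mono) auto
    also have "\<dots> = avg B (\<lambda>b. avg B (\<lambda>b'. of_bool (b' = b))) + 1 / 2 ^ d"
      using B by (simp add: avg_Times avg_add avg_const eq_commute)
    also have "avg B (\<lambda>b. avg B (\<lambda>b'. of_bool (b' = b))) = 1 / 2 ^ m"
      using B by (simp add: avg_of_bool_eq avg_const cong: avg_cong)
    finally show "avg (B \<times> B) (\<lambda>(b, b'). avg (T \<times> T) (\<lambda>w. of_bool (y b w = y b' w)))
        \<le> 1 / 2 ^ m + 1 / 2 ^ d" .
  qed (use \<alpha> in auto)
  finally show ?thesis by (simp add: avg_Times y_def T_def B_def)
qed

section \<open>The tester\<close>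

definition rounds :: "nat \<Rightarrow> nat \<Rightarrow> (point list \<times> point list \<times> bool list) set" where
  "rounds d m = tuples m (cube d) \<times> tuples m (cube d) \<times> tuples m UNIV"

definition round_queries :: "nat \<Rightarrow> point list \<times> point list \<times> bool list \<Rightarrow> point list" where
  "round_queries d = (\<lambda>(u, v, b). u @ v @ [xsum d (sel b u v)])"

definition round_passes :: "nat \<Rightarrow> (point \<Rightarrow> bool) \<Rightarrow> point list \<times> point list \<times> bool list \<Rightarrow> bool" where
  "round_passes d f = (\<lambda>(u, v, b).
     prod_list (map (\<lambda>x. sgb (f x)) (sel b u v)) * sgb (f (xsum d (sel b u v))) = 1)"

definition all_queries :: "nat \<Rightarrow> (point list \<times> point list \<times> bool list) list \<Rightarrow> point list" where
  "all_queries d \<omega> = concat (map (round_queries d) \<omega>)"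

text \<open>The decision rule accepts exactly when some linear function fits all unerased answers,
  so one-sided error holds whatever the adversary does.\<close>

definition consistent :: "nat \<Rightarrow> point list \<Rightarrow> bool option list \<Rightarrow> bool" where
  "consistent d qs ans \<longleftrightarrow>
     (\<exists>g. linear_fun d g \<and> list_all2 (\<lambda>q a. a = None \<or> a = Some (g q)) qs ans)"

definition sum_tester :: "nat \<Rightarrow> nat \<Rightarrow> nat \<Rightarrow> nonadaptive_alg" where
  "sum_tester r d m = map_pmf (\<lambda>\<omega>. (all_queries d \<omega>, consistent d (all_queries d \<omega>)))
     (pmf_of_set (tuples r (rounds d m)))"

lemma finite_rounds [simp]: "finite (rounds d m)"
  and rounds_nonempty [simp]: "rounds d m \<noteq> {}"
  by (auto simp: rounds_def tuples_nonempty)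

lemma set_sum_tester:
  "set_pmf (sum_tester r d m) = (\<lambda>\<omega>. (all_queries d \<omega>, consistent d (all_queries d \<omega>))) ` tuples r (rounds d m)"
  by (simp add: sum_tester_def set_pmf_of_set tuples_nonempty)

lemma length_all_queries:
  "set \<omega> \<subseteq> rounds d m \<Longrightarrow> length (all_queries d \<omega>) = length \<omega> * (2 * m + 1)"
  by (induction \<omega>) (auto simp: all_queries_def rounds_def round_queries_def tuples_def)

lemma set_all_queries: "set \<omega> \<subseteq> rounds d m \<Longrightarrow> set (all_queries d \<omega>) \<subseteq> cube d"
  using xsum_sel_cube
  by (fastforce simp: all_queries_def rounds_def round_queries_def tuples_def[of _ "cube d"])

lemma accept_prob_sum_tester:
  "accept_prob (sum_tester r d m) f adv = avg (tuples r (rounds d m)) (\<lambda>\<omega>.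
     of_bool (consistent d (all_queries d \<omega>) (answers f adv (all_queries d \<omega>))))"
proof -
  let ?R = "tuples r (rounds d m)"
  let ?P = "\<lambda>\<omega>. consistent d (all_queries d \<omega>) (answers f adv (all_queries d \<omega>))"
  have "accept_prob (sum_tester r d m) f adv = real (card (?R \<inter> {\<omega>. ?P \<omega>})) / real (card ?R)"
    unfolding accept_prob_def sum_tester_def measure_map_pmf
    by (subst measure_pmf_of_set) (auto simp: tuples_nonempty vimage_def)
  then show ?thesis by (simp add: avg_def)
qed

lemma sum_tester_one_sided:
  assumes "linear_fun d f"
  shows "accept_prob (sum_tester r d m) f adv = 1"
proof -
  have "consistent d qs (answers f adv qs)" for qs
    using assms answers_sound unfolding consistent_def by blast
  then show ?thesis by (simp add: accept_prob_sum_tester avg_const tuples_nonempty)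
qed

lemma prod_list_sgb_cases: "prod_list (map (\<lambda>x. sgb (f x)) xs) = 1 \<or> prod_list (map (\<lambda>x. sgb (f x)) xs) = -1"
  by (induction xs) (auto simp: sgb_def)

text \<open>The check multiplies signs to \<open>G\<close>, whose values are 1 and -1, so passing
  has indicator \<open>(1 + G) / 2\<close>. Averaging over \<open>b\<close> last reduces the bias to
  that of a uniform tuple.\<close>

lemma avg_round_passes:
  assumes far: "eps_far_linear d \<epsilon> f" and "even m" "m > 0"
  shows "avg (rounds d m) (\<lambda>\<rho>. of_bool (round_passes d f \<rho>)) \<le> (1 + (1 - 2 * \<epsilon>) ^ (m - 1)) / 2"
proof -
  let ?T = "tuples m (cube d)" and ?B = "tuples m (UNIV :: bool set)"
  define G where "G xs = prod_list (map (\<lambda>x. sgb (f x)) xs) * sgb (f (xsum d xs))" for xs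
  have eq: "of_bool (G xs = 1) = (1/2) + (1/2) * G xs" for xs
    using prod_list_sgb_cases[of f xs] by (auto simp: G_def sgb_def)
  have T: "finite ?T" "?T \<noteq> {}" and B: "finite ?B" "?B \<noteq> {}" by (auto simp: tuples_nonempty)
  have "avg (rounds d m) (\<lambda>\<rho>. of_bool (round_passes d f \<rho>))
      = avg ?T (\<lambda>u. avg ?T (\<lambda>v. avg ?B (\<lambda>b. of_bool (G (sel b u v) = 1))))"
    by (simp add: rounds_def round_passes_def avg_Times G_def)
  also have "\<dots> = avg ?T (\<lambda>u. avg ?B (\<lambda>b. avg ?T (\<lambda>v. of_bool (G (sel b u v) = 1))))"
    by (intro avg_cong refl avg_swap)
  also have "\<dots> = avg ?B (\<lambda>b. avg ?T (\<lambda>u. avg ?T (\<lambda>v. of_bool (G (sel b u v) = 1))))"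
    by (rule avg_swap)
  also have "\<dots> = avg ?B (\<lambda>b. avg ?T (\<lambda>xs. of_bool (G xs = 1)))"
  proof (rule avg_cong[OF refl])
    fix b :: "bool list" assume "b \<in> ?B"
    then have "length b = m" by (simp add: tuples_def)
    then show "avg ?T (\<lambda>u. avg ?T (\<lambda>v. of_bool (G (sel b u v) = 1))) = avg ?T (\<lambda>xs. of_bool (G xs = 1))"
      using avg_sel[of "cube d" b "\<lambda>xs. of_bool (G xs = 1)"] by simp
  qed
  also have "\<dots> = 1/2 + (1/2) * avg ?T G"
    using B T unfolding eq avg_add avg_cmult by (simp add: avg_const)
  also have "avg ?T G \<le> (1 - 2 * \<epsilon>) ^ (m - 1)"
    using avg_sum_test_le[OF assms] unfolding G_def[abs_def] .
  finally show ?thesis by simp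
qed

text \<open>For \<open>\<epsilon> \<le> 1/2\<close>, multiplying by
  \<open>(1 + 2 * \<epsilon>) ^ n\<close>, which is at least 3 by Bernoulli, gives a product of at
  most 1. For larger \<open>\<epsilon>\<close> the base is negative and the odd power is not
  positive.\<close>

lemma power_one_minus_le:
  fixes \<epsilon> :: real
  assumes "0 < \<epsilon>" "odd n" "1 / \<epsilon> \<le> real n"
  shows "(1 - 2 * \<epsilon>) ^ n \<le> 1 / 3"
proof (cases "\<epsilon> \<le> 1/2")
  case True
  have "1 \<le> real n * \<epsilon>" using assms by (simp add: field_simps)
  then have "3 \<le> 1 + real n * (2 * \<epsilon>)" by simp
  also have "\<dots> \<le> (1 + 2 * \<epsilon>) ^ n"
    using Bernoulli_inequality[of "2 * \<epsilon>" n] assms by simp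
  finally have *: "3 \<le> (1 + 2 * \<epsilon>) ^ n" .
  have "(1 - 2 * \<epsilon>) ^ n * 3 \<le> (1 - 2 * \<epsilon>) ^ n * (1 + 2 * \<epsilon>) ^ n"
    using True * by (intro mult_left_mono) auto
  also have "\<dots> = (1 - 4 * \<epsilon> ^ 2) ^ n"
    by (simp add: power_mult_distrib[symmetric] algebra_simps power2_eq_square)
  also have "\<dots> \<le> 1"
  proof (rule power_le_one)
    have "\<epsilon> ^ 2 \<le> (1/2) ^ 2" using True assms by (intro power_mono) auto
    then show "0 \<le> 1 - 4 * \<epsilon> ^ 2" by (simp add: power2_eq_square)
  qed simp
  finally show ?thesis by simp
next
  case False
  then have "(1 - 2 * \<epsilon>) ^ n \<le> 0"
    using \<open>odd n\<close> by (simp add: power_le_zero_eq odd_pos)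
  then show ?thesis by simp
qed

lemma of_bool_list_all:
  "of_bool (\<forall>\<rho>\<in>set \<omega>. P \<rho>) = prod_list (map (\<lambda>\<rho>. of_bool (P \<rho>) :: real) \<omega>)"
  by (induction \<omega>) (simp_all add: of_bool_conj)

lemma round_passes_linear:
  assumes g: "linear_fun d g" and \<rho>: "\<rho> \<in> rounds d m"
    and fg: "\<And>x. x \<in> set (round_queries d \<rho>) \<Longrightarrow> f x = g x"
  shows "round_passes d f \<rho>"
proof -
  obtain u v b where [simp]: "\<rho> = (u, v, b)" by (cases \<rho>)
  obtain a where a: "\<And>x. x \<in> cube d \<Longrightarrow> sgb (g x) = chi a x"
    using linear_fun_chiE[OF g] by blast
  let ?s = "sel b u v"
  have uv: "u \<in> tuples m (cube d)" "v \<in> tuples m (cube d)" using \<rho> by (auto simp: rounds_def)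
  have s: "set ?s \<subseteq> cube d" using set_sel_subset[of b u v] uv by (auto simp: tuples_def)
  have "sgb (f x) = chi a x" if x: "x \<in> set ?s" for x
  proof -
    have "x \<in> cube d" using x s by auto
    moreover have "f x = g x"
      using x set_sel_subset[of b u v] by (intro fg) (auto simp: round_queries_def)
    ultimately show ?thesis using a by simp
  qed
  then have "prod_list (map (\<lambda>x. sgb (f x)) ?s) = chi a (xsum d ?s)"
    unfolding chi_xsum[OF s] by (metis (no_types, lifting) map_cong)
  moreover have "sgb (f (xsum d ?s)) = chi a (xsum d ?s)"
    using a[OF xsum_cube[OF s]] fg[of "xsum d ?s"] by (simp add: round_queries_def)
  ultimately show ?thesis
    using chi_cases[of a "xsum d ?s"] by (auto simp: round_passes_def)
qed

lemma consistent_imp_passes: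
  assumes "set \<omega> \<subseteq> rounds d m"
    and "consistent d (all_queries d \<omega>) (map (\<lambda>q. Some (f q)) (all_queries d \<omega>))"
  shows "\<forall>\<rho>\<in>set \<omega>. round_passes d f \<rho>"
proof -
  obtain g where g: "linear_fun d g" and "\<forall>q\<in>set (all_queries d \<omega>). f q = g q"
    using assms(2) by (auto simp: consistent_def list_all2_map2 list_all2_same)
  then show ?thesis
    using assms(1) by (auto intro!: round_passes_linear[OF g] simp: all_queries_def)
qed

text \<open>Union bound over \<open>u\<close>, \<open>v\<close> and the sum. When the sum is
  queried, the adversary has seen \<open>u\<close> and \<open>v\<close> but not \<open>b\<close>, so
  for fixed \<open>h\<close> the set \<open>E (h @ u @ v)\<close> has the form required by
  \<open>avg_sum_erased\<close>.\<close>

lemma avg_round_hit: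
  fixes \<alpha> K :: real
  assumes E: "\<And>h. finite (E h) \<and> real (card (E h)) \<le> K" and \<alpha>: "\<alpha> > 0"
  shows "avg (rounds d m) (\<lambda>\<rho>. of_bool (hit E h (round_queries d \<rho>)))
    \<le> 2 * real m * K / 2 ^ d + \<alpha> * K + (1 / 2 ^ m + 1 / 2 ^ d) / (4 * \<alpha>)"
proof -
  let ?T = "tuples m (cube d)" and ?B = "tuples m (UNIV :: bool set)"
  have T: "finite ?T" "?T \<noteq> {}" and B: "finite ?B" "?B \<noteq> {}" by (auto simp: tuples_nonempty)
  let ?y = "\<lambda>u v b. of_bool (xsum d (sel b u v) \<in> E (h @ u @ v)) :: real"
  have "avg (rounds d m) (\<lambda>\<rho>. of_bool (hit E h (round_queries d \<rho>)))
      \<le> avg (rounds d m) (\<lambda>(u, v, b). of_bool (hit E h u) + (of_bool (hit E (h @ u) v) + ?y u v b))"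
    by (intro avg_mono) (auto simp: round_queries_def hit_append)
  also have "\<dots> = avg ?T (\<lambda>u. of_bool (hit E h u)) + (avg ?T (\<lambda>u. avg ?T (\<lambda>v. of_bool (hit E (h @ u) v)))
      + avg ?T (\<lambda>u. avg ?T (\<lambda>v. avg ?B (?y u v))))"
    using T B by (simp add: rounds_def avg_Times avg_add avg_const)
  also have "\<dots> \<le> real m * (K / 2 ^ d) + (real m * (K / 2 ^ d)
      + (\<alpha> * K + (1 / 2 ^ m + 1 / 2 ^ d) / (4 * \<alpha>)))"
    using E \<alpha> T by (intro add_mono avg_hit_uniform avg_sum_erased avg_le_const)
  finally show ?thesis by (simp add: mult_ac add.assoc)
qed

text \<open>Acceptance requires an erased query or that all rounds pass. The rounds are independent,
  and each passes with probability at most \<open>(1 + 1/3) / 2 = 2/3\<close>.\<close>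

lemma sum_tester_accept_far:
  assumes far: "eps_far_linear d \<epsilon> f" and m: "even m" "m > 0" "0 < \<epsilon>" "1 / \<epsilon> \<le> real (m - 1)"
    and hit: "avg (tuples r (rounds d m)) (\<lambda>\<omega>. of_bool (hit (erased f adv) [] (all_queries d \<omega>))) \<le> \<delta>"
  shows "accept_prob (sum_tester r d m) f adv \<le> \<delta> + (2/3) ^ r"
proof -
  let ?R = "tuples r (rounds d m)"
  have "accept_prob (sum_tester r d m) f adv
      \<le> avg ?R (\<lambda>\<omega>. of_bool (hit (erased f adv) [] (all_queries d \<omega>))
          + of_bool (\<forall>\<rho>\<in>set \<omega>. round_passes d f \<rho>))"
    unfolding accept_prob_sum_tester
  proof (rule avg_mono)
    fix \<omega> assume "\<omega> \<in> ?R"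
    then have "set \<omega> \<subseteq> rounds d m" by (simp add: tuples_def)
    from consistent_imp_passes[OF this, of f] answers_no_hit[of f adv "all_queries d \<omega>"]
    show "of_bool (consistent d (all_queries d \<omega>) (answers f adv (all_queries d \<omega>)))
      \<le> (of_bool (hit (erased f adv) [] (all_queries d \<omega>)) + of_bool (\<forall>\<rho>\<in>set \<omega>. round_passes d f \<rho>) :: real)"
      by (cases "hit (erased f adv) [] (all_queries d \<omega>)") auto
  qed
  also have "\<dots> \<le> \<delta> + avg (rounds d m) (\<lambda>\<rho>. of_bool (round_passes d f \<rho>)) ^ r"
    using hit unfolding avg_add of_bool_list_all avg_tuples_prod_list by simp
  also have "\<dots> \<le> \<delta> + (2/3) ^ r"
  proof (intro add_left_mono power_mono)
    have "(1 - 2 * \<epsilon>) ^ (m - 1) \<le> 1 / 3"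
      using m by (intro power_one_minus_le) auto
    then show "avg (rounds d m) (\<lambda>\<rho>. of_bool (round_passes d f \<rho>)) \<le> 2/3"
      by (intro order.trans[OF avg_round_passes[OF far m(1,2)]]) simp
    show "0 \<le> avg (rounds d m) (\<lambda>\<rho>. of_bool (round_passes d f \<rho>))"
      by (simp add: avg_def)
  qed
  finally show ?thesis .
qed

lemma avg_all_queries_hit:
  fixes \<alpha> :: real
  assumes adv: "valid_adversary t adv" and \<alpha>: "\<alpha> > 0" and K: "K = real (t * (r * (2 * m + 1)))"
  shows "avg (tuples r (rounds d m)) (\<lambda>\<omega>. of_bool (hit (erased f adv) [] (all_queries d \<omega>)))
    \<le> real r * (2 * real m * K / 2 ^ d + \<alpha> * K + (1 / 2 ^ m + 1 / 2 ^ d) / (4 * \<alpha>))"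
proof -
  let ?N = "r * (2 * m + 1)"
  define E where "E h = (if length h < ?N then erased f adv h else {})" for h
  have E: "finite (E h) \<and> real (card (E h)) \<le> K" for h
  proof -
    have "card (erased f adv h) \<le> t * ?N" if "length h < ?N"
      using erased_bound(2)[OF adv, of f h] mult_le_mono2[of "length h" ?N t] that by linarith
    then show ?thesis
      using erased_bound(1)[OF adv] unfolding E_def K by (simp del: of_nat_mult)
  qed
  have "avg (tuples r (rounds d m)) (\<lambda>\<omega>. of_bool (hit (erased f adv) [] (all_queries d \<omega>)))
      = avg (tuples r (rounds d m)) (\<lambda>\<omega>. of_bool (hit E [] (all_queries d \<omega>)))"
  proof (intro avg_cong refl)
    fix \<omega> assume "\<omega> \<in> tuples r (rounds d m)"
    then have "length (all_queries d \<omega>) = ?N"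
      using length_all_queries[of \<omega> d m] by (simp add: tuples_def)
    then show "of_bool (hit (erased f adv) [] (all_queries d \<omega>)) = (of_bool (hit E [] (all_queries d \<omega>)) :: real)"
      unfolding E_def by (subst hit_truncate) auto
  qed
  also have "\<dots> \<le> real r * (2 * real m * K / 2 ^ d + \<alpha> * K + (1 / 2 ^ m + 1 / 2 ^ d) / (4 * \<alpha>))"
    unfolding all_queries_def
    by (intro avg_hit_concat avg_round_hit[OF E \<alpha>]) simp_all
  finally show ?thesis .
qed

text \<open>Serves the case \<open>t = 0\<close>, where \<open>K = 0\<close> and the choice
  \<open>1 / (90 * K)\<close> for \<open>\<alpha>\<close> is not positive.\<close>

lemma no_hit_without_erasures:
  assumes "valid_adversary 0 adv"
  shows "\<not> hit (erased f adv) h qs"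
proof -
  have "erased f adv h = {}" for h
    using erased_bound[OF assms, of f h] by simp
  then show ?thesis by (induction qs arbitrary: h) auto
qed

section \<open>Choice of parameters\<close>

text \<open>The tuple length is twice this number, hence even. The first summand controls the bias,
  the logarithm makes \<open>2 ^ half_size\<close> exceed \<open>t\<close>, and 12 provides the
  slack \<open>2 ^ 12 = 4096\<close> used in \<open>t_times_queries_le\<close>.\<close>

definition half_size :: "nat \<Rightarrow> real \<Rightarrow> nat" where
  "half_size t \<epsilon> = nat \<lceil>1 / \<epsilon>\<rceil> + nat \<lceil>log 2 (real t)\<rceil> + 12"

lemma half_size_ge:
  assumes "0 < \<epsilon>"
  shows "1 / \<epsilon> \<le> real (2 * half_size t \<epsilon> - 1)"
proof -
  have ge: "n \<le> 2 * (n + k + 12) - 1" for n k :: nat by simp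
  have "1 / \<epsilon> \<le> real (nat \<lceil>1 / \<epsilon>\<rceil>)" by (rule real_nat_ceiling_ge)
  also have "\<dots> \<le> real (2 * half_size t \<epsilon> - 1)"
    unfolding half_size_def of_nat_le_iff by (rule ge)
  finally show ?thesis .
qed

lemma half_size_le:
  assumes "0 < \<epsilon>" "\<epsilon> < 1" "t \<ge> 1"
  shows "real (half_size t \<epsilon>) \<le> 15 / \<epsilon> + 2 * ln (real t)"
proof -
  have l: "0 \<le> ln (real t)" using assms by simp
  have "real (nat \<lceil>1 / \<epsilon>\<rceil>) \<le> 1 / \<epsilon> + 1" using assms by (simp add: of_nat_nat)
  moreover have "real (nat \<lceil>log 2 (real t)\<rceil>) \<le> log 2 (real t) + 1"
    using assms by (simp add: of_nat_nat zero_le_log_cancel_iff)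
  moreover have "log 2 (real t) \<le> 2 * ln (real t)"
  proof -
    have "1 / 2 \<le> ln (2::real)" using ln_2_less_1 ln_le_minus_one[of "1/2::real"] by (simp add: ln_div)
    then have "ln (real t) * 1 \<le> ln (real t) * (2 * ln 2)" using l by (intro mult_left_mono) auto
    then show ?thesis using \<open>1 / 2 \<le> ln 2\<close> by (simp add: log_def field_simps)
  qed
  moreover have "1 \<le> 1 / \<epsilon>" using assms by simp
  moreover have "15 / \<epsilon> = 15 * (1 / \<epsilon>)" by simp
  ultimately show ?thesis unfolding half_size_def of_nat_add of_nat_numeral by linarith
qed

lemma half_size_le_div:
  assumes "0 < \<epsilon>" "\<epsilon> < 1" "t \<ge> 1"
  shows "real (half_size t \<epsilon>) \<le> 17 * (real t / \<epsilon>)"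
proof -
  have "ln (real t) \<le> real t" using ln_le_minus_one[of "real t"] assms by simp
  also have "\<dots> \<le> real t / \<epsilon>" using assms by (simp add: field_simps)
  finally have "ln (real t) \<le> real t / \<epsilon>" .
  moreover have "1 / \<epsilon> \<le> real t / \<epsilon>" using assms by (simp add: divide_right_mono)
  moreover have "15 / \<epsilon> = 15 * (1 / \<epsilon>)" by simp
  ultimately show ?thesis using half_size_le[OF assms] by linarith
qed

text \<open>For \<open>\<epsilon> \<le> 3/4\<close> the logarithm of \<open>t / \<epsilon>\<close>
  is at least 1/4, so \<open>15 / \<epsilon>\<close> costs 60 units of the first term and
  \<open>2 * ln t\<close> costs 2 more.\<close>

lemma half_size_le_min:
  assumes "0 < \<epsilon>" "\<epsilon> \<le> 3/4" "t \<ge> 1"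
  shows "real (half_size t \<epsilon>) \<le> 62 * min ((1/\<epsilon>) * ln (real t / \<epsilon>)) (real t / \<epsilon>)"
proof -
  have le: "real (half_size t \<epsilon>) \<le> 15 / \<epsilon> + 2 * ln (real t)"
    using assms by (intro half_size_le) auto
  have \<epsilon>1: "1 \<le> 1 / \<epsilon>" using assms by simp
  have split: "ln (real t / \<epsilon>) = ln (real t) + ln (1 / \<epsilon>)"
    using assms by (simp add: ln_div)
  have "1/4 \<le> ln (1 / \<epsilon>)"
    using ln_le_minus_one[of \<epsilon>] assms by (simp add: ln_div)
  moreover have l: "0 \<le> ln (real t)" using assms by simp
  ultimately have ln4: "1/4 \<le> ln (real t / \<epsilon>)" and lnt: "ln (real t) \<le> ln (real t / \<epsilon>)"
    using split by linarith+
  have "15 / \<epsilon> + 2 * ln (real t) \<le> 62 * ((1/\<epsilon>) * ln (real t / \<epsilon>))"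
  proof -
    have "(1/\<epsilon>) * (1/4) \<le> (1/\<epsilon>) * ln (real t / \<epsilon>)"
      using assms ln4 by (intro mult_left_mono) auto
    moreover have "1 * ln (real t) \<le> (1/\<epsilon>) * ln (real t / \<epsilon>)"
      using assms lnt l \<epsilon>1 by (intro mult_mono) auto
    ultimately show ?thesis by simp
  qed
  moreover have "real (half_size t \<epsilon>) \<le> 62 * (real t / \<epsilon>)"
  proof -
    have "0 \<le> real t / \<epsilon>" using assms by simp
    then show ?thesis using half_size_le_div[of \<epsilon> t] assms by linarith
  qed
  ultimately show ?thesis using le by linarith
qed

text \<open>With \<open>m = 2 * half_size\<close>, four rounds make
  \<open>4 * (2 * m + 1) = 16 * half_size + 4\<close> queries. One factor
  \<open>2 ^ half_size\<close> absorbs this number, the other absorbs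
  \<open>4096 * t\<close>.\<close>

lemma t_times_queries_le:
  assumes "0 < \<epsilon>" "t \<ge> 1"
  shows "real (t * (16 * half_size t \<epsilon> + 4)) \<le> 2 ^ (2 * half_size t \<epsilon>) / 4096"
proof -
  let ?s = "half_size t \<epsilon>"
  have lin: "16 * s + 4 \<le> 2 ^ s" if "s \<ge> 12" for s :: nat
    using that
  proof (induction s rule: dec_induct)
    case (step n)
    have "16 * Suc n + 4 \<le> 2 * (16 * n + 4)" using step.hyps by simp
    also have "\<dots> \<le> 2 * 2 ^ n" using step.IH by (rule mult_le_mono2)
    finally show ?case by simp
  qed simp
  define l where "l = nat \<lceil>log 2 (real t)\<rceil>"
  have "real t = 2 powr (log 2 (real t))" using assms by simp
  also have "\<dots> \<le> 2 powr (real l)" unfolding l_def by (intro powr_mono real_nat_ceiling_ge) auto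
  also have "\<dots> = 2 ^ (l + 12) / 4096" by (simp add: powr_realpow power_add)
  also have "\<dots> \<le> 2 ^ ?s / 4096"
    unfolding half_size_def l_def by (intro divide_right_mono power_increasing) auto
  finally have t: "real t \<le> 2 ^ ?s / 4096" .
  have "real (16 * ?s + 4) \<le> real (2 ^ ?s)"
    by (intro of_nat_mono lin) (simp add: half_size_def)
  then have "real t * real (16 * ?s + 4) \<le> (2 ^ ?s / 4096) * 2 ^ ?s"
    using t by (intro mult_mono) auto
  then show ?thesis by (simp add: power_add[symmetric] mult_2)
qed

text \<open>The fourth power of the hypothesis reads
  \<open>10 ^ 8 * t ^ 4 \<le> \<epsilon> ^ 5 * 2 ^ d\<close>. The exponents are then relaxed to
  \<open>t ^ 3 / \<epsilon> ^ 2\<close>, the order of \<open>m * K\<close> in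
  \<open>erasure_budget\<close>.\<close>

lemma cube_size_bound:
  assumes \<epsilon>: "0 < \<epsilon>" "\<epsilon> < 1" and t: "t \<ge> 1"
    and le: "real t \<le> 1/100 * \<epsilon> powr (5/4) * 2 powr (real d / 4)"
  shows "100000000 * (real t ^ 3 / \<epsilon> ^ 2) \<le> 2 ^ d"
proof -
  have "real t ^ 4 \<le> (1/100 * \<epsilon> powr (5/4) * 2 powr (real d / 4)) ^ 4"
    using le by (intro power_mono) auto
  also have "\<dots> = (1/100) ^ 4 * (\<epsilon> powr (5/4)) ^ 4 * (2 powr (real d / 4)) ^ 4"
    by (simp only: power_mult_distrib)
  also have "(\<epsilon> powr (5/4)) ^ 4 = \<epsilon> ^ 5"
    using \<epsilon> by (simp add: powr_power powr_numeral)
  also have "((2::real) powr (real d / 4)) ^ 4 = 2 ^ d"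
    by (simp add: powr_power powr_realpow)
  also have "(1/100) ^ 4 * \<epsilon> ^ 5 * 2 ^ d = \<epsilon> ^ 5 * 2 ^ d / (100000000::real)"
    by (simp add: power_divide)
  finally have *: "100000000 * real t ^ 4 \<le> \<epsilon> ^ 5 * 2 ^ d"
    by (simp add: pos_le_divide_eq mult.commute)
  have "100000000 * real t ^ 3 \<le> 100000000 * real t ^ 4"
    using t by (intro mult_left_mono power_increasing) auto
  also note *
  also have "\<epsilon> ^ 5 * 2 ^ d \<le> \<epsilon> ^ 2 * 2 ^ d"
    using \<epsilon> by (intro mult_right_mono power_decreasing) auto
  finally have "100000000 * real t ^ 3 \<le> 2 ^ d * \<epsilon> ^ 2" by (simp add: mult.commute)
  then show ?thesis using \<epsilon> by (simp add: divide_le_eq)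
qed

text \<open>The choice \<open>\<alpha> = 1 / (90 * K)\<close> makes the linear AM-GM term 1/90 and
  turns the collision term into \<open>45/2 * (K / 2 ^ m + K / 2 ^ d)\<close>.\<close>

lemma erasure_budget:
  fixes t d :: nat and \<epsilon> :: real
  defines "m \<equiv> 2 * half_size t \<epsilon>"
  defines "K \<equiv> real (t * (4 * (2 * m + 1)))"
  assumes \<epsilon>: "0 < \<epsilon>" "\<epsilon> < 1" and t: "t \<ge> 1"
    and le: "real t \<le> 1/100 * \<epsilon> powr (5/4) * 2 powr (real d / 4)"
  shows "2 * real m * K / 2 ^ d + 1 / (90 * K) * K + (1 / 2 ^ m + 1 / 2 ^ d) / (4 * (1 / (90 * K))) \<le> 1/30"
proof -
  have K: "K > 0" using t by (simp add: K_def)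
  have m12: "real m \<ge> 24" by (simp add: m_def half_size_def)
  have Km: "K \<le> 2 ^ m / 4096"
    using t_times_queries_le[OF \<epsilon>(1) t] by (simp add: K_def m_def add.commute)
  have "real m \<le> 34 * (real t / \<epsilon>)"
    using half_size_le_div[OF \<epsilon> t] by (simp add: m_def)
  then have "real m ^ 2 \<le> (34 * (real t / \<epsilon>)) ^ 2" by (intro power_mono) auto
  then have m2: "real m ^ 2 \<le> 1156 * (real t ^ 2 / \<epsilon> ^ 2)"
    by (simp add: power_mult_distrib power_divide)
  \<comment> \<open>Since \<open>m \<ge> 4\<close>,
    \<open>4 * (2 * m + 1) \<le> 9 * m\<close>.\<close>
  have "real m * K \<le> real m * (real t * (9 * real m))"
    using m12 t unfolding K_def by (intro mult_left_mono) (simp_all add: mult_left_mono)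
  also have "\<dots> = 9 * real t * real m ^ 2" by (simp add: power2_eq_square)
  also have "\<dots> \<le> 9 * real t * (1156 * (real t ^ 2 / \<epsilon> ^ 2))"
    using m2 by (intro mult_left_mono) auto
  also have "\<dots> = 10404 * (real t ^ 3 / \<epsilon> ^ 2)" by (simp add: power3_eq_cube power2_eq_square)
  also have "\<dots> \<le> 10404 * (2 ^ d / 100000000)"
    using cube_size_bound[OF \<epsilon> t le]
    by (intro mult_left_mono) (simp_all add: pos_le_divide_eq mult.commute)
  also have "\<dots> \<le> 2 ^ d / 9000" by simp
  finally have mK: "real m * K \<le> 2 ^ d / 9000" .
  have "24 * K \<le> real m * K" using m12 K by (intro mult_right_mono) auto
  then have Kd: "K \<le> 2 ^ d / 216000" using mK by simp
  have "2 * real m * K / 2 ^ d \<le> 1/4500" "K / 2 ^ d \<le> 1/216000" "K / 2 ^ m \<le> 1/4096"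
    using mK Kd Km by (simp_all add: divide_le_eq)
  moreover have "(1 / 2 ^ m + 1 / 2 ^ d) / (4 * (1 / (90 * K))) = 45/2 * (K / 2 ^ m + K / 2 ^ d)"
    using K by (simp add: field_simps)
  moreover have "1 / (90 * K) * K = 1/90" using K by simp
  moreover have "x + 1/90 + 45/2 * (y + z) \<le> 1/30"
    if "x \<le> 1/4500" "z \<le> 1/216000" "y \<le> 1/4096" for x y z :: real
    using that by argo
  ultimately show ?thesis by metis
qed

text \<open>For \<open>t = 0\<close> the size hypothesis puts no lower bound on \<open>d\<close>,
  and when \<open>d = 0\<close> the constant True is far for every \<open>\<epsilon> < 1\<close>;
  queries are then made even for large \<open>\<epsilon>\<close>.\<close>

definition linearity_tester :: "nat \<Rightarrow> nat \<Rightarrow> real \<Rightarrow> nonadaptive_alg" where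
  "linearity_tester d t \<epsilon> = (if t \<ge> 1 \<and> \<epsilon> > 3/4 then return_pmf ([], \<lambda>_. True)
     else sum_tester 4 d (2 * half_size t \<epsilon>))"

lemma linearity_tester_correct:
  assumes \<epsilon>: "0 < \<epsilon>" "\<epsilon> < 1"
    and le: "real t \<le> 1/100 * \<epsilon> powr (5/4) * 2 powr (real d / 4)"
  shows "one_sided_oe_linearity_tester d t \<epsilon> (linearity_tester d t \<epsilon>)"
proof (cases "t \<ge> 1 \<and> \<epsilon> > 3/4")
  case True
  then have t: "t \<ge> 1" by simp
  have "1 \<le> real t ^ 3 / \<epsilon> ^ 2"
  proof -
    have "\<epsilon> ^ 2 \<le> 1" "1 \<le> real t ^ 3" using \<epsilon> t by (auto intro: power_le_one one_le_power)
    then show ?thesis using \<epsilon> by (simp add: le_divide_eq)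
  qed
  then have "(100000000::real) * 1 \<le> 100000000 * (real t ^ 3 / \<epsilon> ^ 2)" by (intro mult_left_mono) auto
  also note cube_size_bound[OF \<epsilon> t le]
  finally have big: "(100000000::real) * 1 \<le> 2 ^ d" .
  have "d \<ge> 2"
  proof (rule ccontr)
    assume "\<not> d \<ge> 2"
    then have "(2::real) ^ d \<le> 2 ^ 1" by (intro power_increasing) auto
    with big show False by simp
  qed
  then have "\<not> eps_far_linear d \<epsilon> f" for f using True not_far_of_large_eps by blast
  then show ?thesis
    using True by (simp add: one_sided_oe_linearity_tester_def linearity_tester_def accept_prob_def)
next
  case False
  define m where "m = 2 * half_size t \<epsilon>"
  have T: "linearity_tester d t \<epsilon> = sum_tester 4 d m"
    using False by (auto simp: linearity_tester_def m_def)
  have m: "even m" "m > 0" "1 / \<epsilon> \<le> real (m - 1)"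
    using half_size_ge[OF \<epsilon>(1)] by (auto simp: m_def half_size_def)
  have rej: "accept_prob (sum_tester 4 d m) f adv \<le> 1/3"
    if adv: "valid_adversary t adv" and far: "eps_far_linear d \<epsilon> f" for f adv
  proof -
    have "avg (tuples 4 (rounds d m)) (\<lambda>\<omega>. of_bool (hit (erased f adv) [] (all_queries d \<omega>))) \<le> 4 * (1/30)"
    proof (cases "t = 0")
      case True
      then show ?thesis using no_hit_without_erasures adv by (simp add: avg_def)
    next
      case False
      then have t: "t \<ge> 1" by simp
      define K where "K = real (t * (4 * (2 * m + 1)))"
      have K: "K > 0" using t by (simp add: K_def)
      have "avg (tuples 4 (rounds d m)) (\<lambda>\<omega>. of_bool (hit (erased f adv) [] (all_queries d \<omega>)))
          \<le> real 4 * (2 * real m * K / 2 ^ d + 1 / (90 * K) * K + (1 / 2 ^ m + 1 / 2 ^ d) / (4 * (1 / (90 * K))))"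
        using K by (intro avg_all_queries_hit[OF adv _ K_def]) auto
      also have "\<dots> \<le> real 4 * (1/30)"
        unfolding K_def m_def using erasure_budget[OF \<epsilon> t le] by (intro mult_left_mono) auto
      finally show ?thesis by simp
    qed
    \<comment> \<open>Four rounds suffice because \<open>4/30 + (2/3) ^ 4 < 1/3\<close>.\<close>
    from sum_tester_accept_far[OF far m(1,2) \<epsilon>(1) m(3) this]
    show ?thesis by (simp add: power_divide)
  qed
  have "set qs \<subseteq> cube d" if "(qs, dec) \<in> set_pmf (sum_tester 4 d m)" for qs dec
    using that set_all_queries[of _ d m] by (auto simp: set_sum_tester tuples_def)
  then show ?thesis
    unfolding one_sided_oe_linearity_tester_def T
    using sum_tester_one_sided rej by fastforce
qed

lemma linearity_tester_queries:
  assumes \<epsilon>: "0 < \<epsilon>" "\<epsilon> < 1" and t: "t \<ge> 1"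
    and qs: "(qs, dec) \<in> set_pmf (linearity_tester d t \<epsilon>)"
  shows "real (length qs) \<le> 1500 * min ((1/\<epsilon>) * ln (real t / \<epsilon>)) (real t / \<epsilon>)"
proof (cases "\<epsilon> > 3/4")
  case True
  have "1 \<le> real t / \<epsilon>" using \<epsilon> t by (simp add: le_divide_eq)
  then show ?thesis using True qs \<epsilon> t by (simp add: linearity_tester_def)
next
  case False
  let ?s = "half_size t \<epsilon>"
  have "length qs = 4 * (2 * (2 * ?s) + 1)"
    using qs False length_all_queries[of _ d "2 * ?s"]
    by (auto simp: linearity_tester_def set_sum_tester tuples_def)
  moreover have "real ?s \<ge> 12" by (simp add: half_size_def)
  \<comment> \<open>The length is \<open>16 * half_size + 4\<close>; the next bound multiplies 24 by
    62, giving 1488, which is rounded up to 1500.\<close>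
  ultimately have "real (length qs) \<le> 24 * real ?s" by simp
  also have "\<dots> \<le> 24 * (62 * min ((1/\<epsilon>) * ln (real t / \<epsilon>)) (real t / \<epsilon>))"
    using half_size_le_min[of \<epsilon> t] False \<epsilon> t by simp
  also have "\<dots> \<le> 1500 * min ((1/\<epsilon>) * ln (real t / \<epsilon>)) (real t / \<epsilon>)"
  proof -
    have "0 \<le> min ((1/\<epsilon>) * ln (real t / \<epsilon>)) (real t / \<epsilon>)"
      using \<epsilon> t by (simp add: le_divide_eq)
    then show ?thesis by linarith
  qed
  finally show ?thesis .
qed

theorem theorem1p1:
  shows "\<exists>c0::real. 0 < c0 \<and> c0 < 1 \<and>
    (\<exists>(C::real) (T :: nat \<Rightarrow> nat \<Rightarrow> real \<Rightarrow> nonadaptive_alg).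
      \<forall>d t \<epsilon>. 0 < \<epsilon> \<and> \<epsilon> < 1 \<and> real t \<le> c0 * \<epsilon> powr (5/4) * 2 powr (real d / 4) \<longrightarrow>
        one_sided_oe_linearity_tester d t \<epsilon> (T d t \<epsilon>) \<and>
        (t \<ge> 1 \<longrightarrow> (\<forall>(qs, dec) \<in> set_pmf (T d t \<epsilon>).
           real (length qs) \<le> C * min ((1/\<epsilon>) * ln (real t / \<epsilon>)) (real t / \<epsilon>))))"
proof (rule exI[of _ "1/100"], intro conjI exI[of _ "1500 :: real"] exI[of _ linearity_tester] allI impI; (elim conjE)?)
  fix d t and \<epsilon> :: real
  assume \<epsilon>: "0 < \<epsilon>" "\<epsilon> < 1"
    and le: "real t \<le> 1/100 * \<epsilon> powr (5/4) * 2 powr (real d / 4)"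
  show "one_sided_oe_linearity_tester d t \<epsilon> (linearity_tester d t \<epsilon>)"
    using \<epsilon> le by (rule linearity_tester_correct)
  assume "t \<ge> 1"
  then show "\<forall>(qs, dec) \<in> set_pmf (linearity_tester d t \<epsilon>).
      real (length qs) \<le> 1500 * min ((1/\<epsilon>) * ln (real t / \<epsilon>)) (real t / \<epsilon>)"
    using linearity_tester_queries[OF \<epsilon>] by blast
qed simp_all

end
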